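(* Let $\Lambda=k\Lambda_0+\lambda$ be a generic affine weight of non-critical level $k\neq-h^\vee$, and let $\widehat\mu=(\mu_0,\dots,\mu_r)\in(\mathbb C^* )^{r+1}$. The Whittaker vector $|w\rangle_\Lambda^{\widehat\mu}$ for $\widehat{\mathfrak g}$ in the completion of $V_\Lambda$ with character $\widehat\mu$ (the unique element with $\langle\Lambda|w\rangle=1$ and $e_i|w\rangle=\mu_i|w\rangle$ for $i=0,\dots,r$) is given by $$|w\rangle_\Lambda^{\widehat\mu}=\sum_{\widehat\beta\in\widehat Q_+}\Big(\prod_{i=0}^r(d_i\mu_i)^{\beta_i}\Big)\,|Z_{\widehat\beta}\rangle ,\qquad |Z_{\widehat\beta}\rangle=\sum_{\mathbf p\in\mathcal P_{\widehat\beta}}x(\mathbf p)\,|\mathbf p\rangle ,$$ where $\widehat\beta=\sum_{i=0}^r\beta_i\alpha_i$, and $x(\mathbf p)$ is the product of the inverses of the vertex weights $\widehat v(\widehat\beta)=(\Lambda+\widehat\rho|\widehat\beta)-\frac12(\widehat\beta|\widehat\beta)$ at the non-zero vertices visited by $\mathbf p$.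
   Context: Affine data. $\widehat{\mathfrak g}=\mathfrak n_-\oplus\mathfrak h\oplus\mathfrak n_+$ is the non-twisted affine Lie algebra associated with a finite-dimensional simple Lie algebra $\mathfrak g$ of rank $r$, with simple roots $\alpha_0,\dots,\alpha_r$ ($\alpha_1,\dots,\alpha_r$ those of $\mathfrak g$), Cartan matrix $\widehat C$, and Chevalley generators $e_i,f_i,h_i$, $0\le i\le r$, with $[h_i,h_j]=0$, $[h_i,e_j]=\widehat C_{j,i}e_j$, $[h_i,f_j]=-\widehat C_{j,i}f_j$, $[e_i,f_j]=\delta_{i,j}h_j$ and the Serre relations. The positive numbers $d_i$ satisfy $\widehat C_{i,j}d_j=\widehat C_{j,i}d_i$ and $d_0=1$; $\alpha_i=d_i\alpha_i^\vee$; the symmetric bilinear form satisfies $(\alpha_i|\alpha_j^\vee)=\widehat C_{i,j}$. $\theta=\sum_{i=1}^ra_i\alpha_i$ is the highest root of $\mathfrak g$, $a_0=1$, $\delta=\alpha_0+\theta$; the co-marks are $a_i^\vee=d_ia_i$, $h^\vee=\sum_{i=0}^ra_i^\vee$ is the dual Coxeter number, and $c=\sum_ia_i^\vee h_i$ is central. $(\delta|\alpha_i)=(\delta|\delta)=0$, $(\Lambda_0|\alpha_j^\vee)=\delta_{j,0}$, $(\Lambda_0|\delta)=1$, $(\Lambda_0|\Lambda_0)=0$; $\omega_1,\dots,\omega_r$ are the fundamental weights of $\mathfrak g$, orthogonal to $\delta$ and $\Lambda_0$; $\rho=\sum_{i=1}^r\omega_i$; $\widehat\rho=h^\vee\Lambda_0+\rho$,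 so $(\widehat\rho|\alpha_i^\vee)=1$ for $0\le i\le r$. $\widehat Q_+=\bigoplus_{i=0}^r\mathbb Z_{\ge0}\alpha_i$. Verma module. $\Lambda=k\Lambda_0+\lambda$ with $\lambda$ a weight of $\mathfrak g$ and $k\in\mathbb C$ not a positive integer ($k$ is the scalar by which $c$ acts). $V_\Lambda=U(\mathfrak n_-)|\Lambda\rangle$ is the (irreducible) Verma module, with $h_i|\Lambda\rangle=(\Lambda|\alpha_i^\vee)|\Lambda\rangle$, $\mathfrak n_+|\Lambda\rangle=0$, graded by $\widehat Q_+$ with finite-dimensional pieces ($f_{i_N}\cdots f_{i_1}|\Lambda\rangle$ has degree $\alpha_{i_1}+\dots+\alpha_{i_N}$); its completion is the product of these pieces. $\langle\Lambda|$ is the functional equal to $1$ on $|\Lambda\rangle$ and $0$ on pieces of nonzero degree. Paths. $\mathcal P_{\widehat\beta}$ is the set of sequences $\mathbf p=(p_0,\dots,p_N)$ in $\widehat Q_+$ with $p_0=0$, $p_N=\widehat\beta$ and $p_k-p_{k-1}=\alpha_{i_k}$ simple roots ($0\le i_k\le r$); $|\mathbf p\rangle=f_{i_N}\cdots f_{i_1}|\Lambda\rangle$ and $x(\mathbf p)=\prod_{k=1}^N\frac1{\widehat v(p_k)}$. "$\Lambda$ generic" means that $V_\Lambda$ is irreducible and $\widehat v(\widehat\beta)\neq0$ for all $\widehat\beta\in\widehat Q_+\setminus\{0\}$. *)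

theory Defs
  imports Complex_Main "HOL-Library.Poly_Mapping"
    "HOL-Library.Function_Algebras" "HOL-Library.Product_Plus"
begin

(* Conventions.  A finite type 'i indexes the simple roots alpha_1,...,alpha_r of the
   finite-dimensional simple Lie algebra g (so r = CARD('i) \<ge> 1 is arbitrary), and
   'i option indexes those of its affinization: None is the affine node 0 and Some i is i.
   Elements of the positive affine root lattice are the functions beta :: 'i option \<Rightarrow> nat
   of coefficients, with pointwise addition. *)


section \<open>Chevalley--Serre relations\<close>

(* The relators of the Chevalley--Serre presentation with matrix C, for an arbitrary bracket.
   C i j stands for (alpha_i | coroot_j), hence the index order C j i in [h_i, e_j]. *)
definition chevalley_serre_relators ::
  "(complex \<Rightarrow> 'a \<Rightarrow> 'a) \<Rightarrow> ('a \<Rightarrow> 'a \<Rightarrow> 'a::ab_group_add) \<Rightarrow> ('j \<Rightarrow> 'j \<Rightarrow> int) \<Rightarrow>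
   ('j \<Rightarrow> 'a) \<Rightarrow> ('j \<Rightarrow> 'a) \<Rightarrow> ('j \<Rightarrow> 'a) \<Rightarrow> 'a set" where
  "chevalley_serre_relators scale br C e f h =
     {br (h i) (h j) |i j. True} \<union>
     {br (h i) (e j) - scale (of_int (C j i)) (e j) |i j. True} \<union>
     {br (h i) (f j) + scale (of_int (C j i)) (f j) |i j. True} \<union>
     {br (e i) (f j) - (if i = j then h j else 0) |i j. True} \<union>
     {(br (e i) ^^ nat (1 - C j i)) (e j) |i j. i \<noteq> j} \<union>
     {(br (f i) ^^ nat (1 - C j i)) (f j) |i j. i \<noteq> j}"

definition generalized_cartan_matrix :: "('j \<Rightarrow> 'j \<Rightarrow> int) \<Rightarrow> bool" where
  "generalized_cartan_matrix C \<longleftrightarrow>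
     (\<forall>i. C i i = 2) \<and> (\<forall>i j. i \<noteq> j \<longrightarrow> C i j \<le> 0) \<and> (\<forall>i j. C i j = 0 \<longrightarrow> C j i = 0)"


section \<open>Finite-dimensional simple Lie algebras\<close>

locale complex_lie_algebra = vector_space scale
  for scale :: "complex \<Rightarrow> 'g::ab_group_add \<Rightarrow> 'g" +
  fixes br :: "'g \<Rightarrow> 'g \<Rightarrow> 'g"
  assumes br_add_left: "br (x + y) z = br x z + br y z"
    and br_add_right: "br x (y + z) = br x y + br x z"
    and br_scale_left: "br (scale c x) y = scale c (br x y)"
    and br_scale_right: "br x (scale c y) = scale c (br x y)"
    and br_self: "br x x = 0"
    and jacobi: "br x (br y z) + br y (br z x) + br z (br x y) = 0"

definition fd_simple_lie_algebra ::
  "(complex \<Rightarrow> 'g::ab_group_add \<Rightarrow> 'g) \<Rightarrow> ('g \<Rightarrow> 'g \<Rightarrow> 'g) \<Rightarrow> bool" where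
  "fd_simple_lie_algebra scale br \<longleftrightarrow>
     complex_lie_algebra scale br \<and>
     (\<exists>B. finite B \<and> module.span scale B = UNIV) \<and>
     (\<exists>x y. br x y \<noteq> 0) \<and>
     (\<forall>I. module.subspace scale I \<and> (\<forall>x. \<forall>y\<in>I. br x y \<in> I) \<longrightarrow> I = {0} \<or> I = UNIV)"

(* Linear independence of the h_i is what makes the number of nodes the rank: without it, the
   images of the affine generators in g (under evaluation of loops) would qualify as well. *)
definition chevalley_generators ::
  "(complex \<Rightarrow> 'g::ab_group_add \<Rightarrow> 'g) \<Rightarrow> ('g \<Rightarrow> 'g \<Rightarrow> 'g) \<Rightarrow> ('i::finite \<Rightarrow> 'i \<Rightarrow> int) \<Rightarrow>
   ('i \<Rightarrow> 'g) \<Rightarrow> ('i \<Rightarrow> 'g) \<Rightarrow> ('i \<Rightarrow> 'g) \<Rightarrow> bool" where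
  "chevalley_generators scale br C e f h \<longleftrightarrow>
     chevalley_serre_relators scale br C e f h \<subseteq> {0} \<and>
     (\<forall>c. (\<Sum>i\<in>UNIV. scale (c i) (h i)) = 0 \<longrightarrow> (\<forall>i. c i = 0)) \<and>
     (\<forall>S. module.subspace scale S \<and> (\<forall>x\<in>S. \<forall>y\<in>S. br x y \<in> S) \<and> range e \<union> range f \<subseteq> S
          \<longrightarrow> S = UNIV)"

definition is_root ::
  "(complex \<Rightarrow> 'g::ab_group_add \<Rightarrow> 'g) \<Rightarrow> ('g \<Rightarrow> 'g \<Rightarrow> 'g) \<Rightarrow> ('i::finite \<Rightarrow> 'i \<Rightarrow> int) \<Rightarrow>
   ('i \<Rightarrow> 'g) \<Rightarrow> ('i \<Rightarrow> int) \<Rightarrow> bool" where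
  "is_root scale br C h \<beta> \<longleftrightarrow>
     \<beta> \<noteq> 0 \<and> (\<exists>x. x \<noteq> 0 \<and> (\<forall>i. br (h i) x = scale (of_int (\<Sum>j\<in>UNIV. \<beta> j * C j i)) x))"

definition is_highest_root ::
  "(complex \<Rightarrow> 'g::ab_group_add \<Rightarrow> 'g) \<Rightarrow> ('g \<Rightarrow> 'g \<Rightarrow> 'g) \<Rightarrow> ('i::finite \<Rightarrow> 'i \<Rightarrow> int) \<Rightarrow>
   ('i \<Rightarrow> 'g) \<Rightarrow> ('i \<Rightarrow> nat) \<Rightarrow> bool" where
  "is_highest_root scale br C h a \<longleftrightarrow>
     is_root scale br C h (\<lambda>i. int (a i)) \<and>
     (\<forall>\<beta>. is_root scale br C h \<beta> \<longrightarrow> (\<forall>i. \<beta> i \<le> int (a i)))"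


section \<open>Affine data\<close>

fun mark :: "('i \<Rightarrow> nat) \<Rightarrow> 'i option \<Rightarrow> nat" where
  "mark a None = 1"
| "mark a (Some i) = a i"

definition comark :: "('i option \<Rightarrow> real) \<Rightarrow> ('i \<Rightarrow> nat) \<Rightarrow> 'i option \<Rightarrow> real" where
  "comark d a i = d i * real (mark a i)"

definition dual_coxeter :: "('i::finite option \<Rightarrow> real) \<Rightarrow> ('i \<Rightarrow> nat) \<Rightarrow> real" where
  "dual_coxeter d a = (\<Sum>i\<in>UNIV. comark d a i)"

(* C is the Cartan matrix and d the symmetrizer of the non-twisted affinization of g.  The
   condition on the marks says (delta | coroot_j) = 0 for delta = alpha_0 + theta.  For j = Some i
   it gives the row C None (Some i) = - (theta | coroot_i); symmetrizability then gives the column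
   of None, and j = None gives (theta | theta) = 2, which fixes the scale of d. *)
definition nontwisted_affine_data ::
  "(complex \<Rightarrow> 'g::ab_group_add \<Rightarrow> 'g) \<Rightarrow> ('g \<Rightarrow> 'g \<Rightarrow> 'g) \<Rightarrow>
   ('i::finite \<Rightarrow> 'g) \<Rightarrow> ('i \<Rightarrow> 'g) \<Rightarrow> ('i \<Rightarrow> 'g) \<Rightarrow> ('i \<Rightarrow> nat) \<Rightarrow>
   ('i option \<Rightarrow> 'i option \<Rightarrow> int) \<Rightarrow> ('i option \<Rightarrow> real) \<Rightarrow> bool" where
  "nontwisted_affine_data scale br e f h a C d \<longleftrightarrow>
     fd_simple_lie_algebra scale br \<and>
     chevalley_generators scale br (\<lambda>i j. C (Some i) (Some j)) e f h \<and>
     is_highest_root scale br (\<lambda>i j. C (Some i) (Some j)) h a \<and>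
     generalized_cartan_matrix C \<and>
     (\<forall>j. (\<Sum>i\<in>UNIV. int (mark a i) * C i j) = 0) \<and>
     (\<forall>i. d i > 0) \<and> d None = 1 \<and>
     (\<forall>i j. real_of_int (C i j) * d j = real_of_int (C j i) * d i)"


section \<open>Affine weights and the bilinear form\<close>

(* (k, l) is the weight k Lambda_0 + sum_i l_i omega_i. *)
type_synonym 'i weight = "complex \<times> ('i \<Rightarrow> complex)"

(* (Lambda | coroot_j).  Since d_0 = 1, coroot_0 = alpha_0 = delta - theta with
   theta = sum_i a_i d_i coroot_i, and (Lambda_0 | delta) = 1. *)
fun coroot_label ::
  "('i::finite option \<Rightarrow> real) \<Rightarrow> ('i \<Rightarrow> nat) \<Rightarrow> 'i weight \<Rightarrow> 'i option \<Rightarrow> complex" where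
  "coroot_label d a \<Lambda> None =
     fst \<Lambda> - (\<Sum>i\<in>UNIV. complex_of_real (comark d a (Some i)) * snd \<Lambda> i)"
| "coroot_label d a \<Lambda> (Some i) = snd \<Lambda> i"

(* (Lambda | beta), by alpha_i = d_i coroot_i *)
definition weight_root_form ::
  "('i::finite option \<Rightarrow> real) \<Rightarrow> ('i \<Rightarrow> nat) \<Rightarrow> 'i weight \<Rightarrow> ('i option \<Rightarrow> nat) \<Rightarrow> complex" where
  "weight_root_form d a \<Lambda> \<beta> =
     (\<Sum>i\<in>UNIV. of_nat (\<beta> i) * complex_of_real (d i) * coroot_label d a \<Lambda> i)"

(* (beta | gamma), by (alpha_i | alpha_j) = d_j (alpha_i | coroot_j) = C i j * d_j *)
definition root_form ::
  "('i::finite option \<Rightarrow> 'i option \<Rightarrow> int) \<Rightarrow> ('i option \<Rightarrow> real) \<Rightarrow>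
   ('i option \<Rightarrow> nat) \<Rightarrow> ('i option \<Rightarrow> nat) \<Rightarrow> real" where
  "root_form C d \<beta> \<gamma> =
     (\<Sum>i\<in>UNIV. \<Sum>j\<in>UNIV. real (\<beta> i) * real (\<gamma> j) * (real_of_int (C i j) * d j))"

definition rho_hat :: "('i::finite option \<Rightarrow> real) \<Rightarrow> ('i \<Rightarrow> nat) \<Rightarrow> 'i weight" where
  "rho_hat d a = (complex_of_real (dual_coxeter d a), \<lambda>i. 1)"

definition vertex_weight ::
  "('i::finite option \<Rightarrow> 'i option \<Rightarrow> int) \<Rightarrow> ('i option \<Rightarrow> real) \<Rightarrow> ('i \<Rightarrow> nat) \<Rightarrow>
   'i weight \<Rightarrow> ('i option \<Rightarrow> nat) \<Rightarrow> complex" where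
  "vertex_weight C d a \<Lambda> \<beta> =
     weight_root_form d a (\<Lambda> + rho_hat d a) \<beta> - complex_of_real (root_form C d \<beta> \<beta>) / 2"

lemma UNIV_option_sum: "(\<Sum>i\<in>UNIV. g i) = g None + (\<Sum>i\<in>UNIV. g (Some i))"
  for g :: "'i::finite option \<Rightarrow> 'b::comm_monoid_add"
  by (simp add: UNIV_option_conv sum.reindex)

lemma coroot_label_rho_hat:
  assumes "d None = 1"
  shows "coroot_label d a (rho_hat d a) i = 1"
  using assms by (cases i) (simp_all add: rho_hat_def dual_coxeter_def UNIV_option_sum comark_def)

(* the central element c = sum_i a_i^vee h_i acts by the level *)
lemma level_eq_sum_comark_coroot_label:
  assumes "d None = 1"
  shows "(\<Sum>i\<in>UNIV. complex_of_real (comark d a i) * coroot_label d a \<Lambda> i) = fst \<Lambda>"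
  using assms by (simp add: UNIV_option_sum comark_def)


section \<open>The enveloping algebra by generators and relations\<close>

datatype 'x word = Word (letters: "'x list")

instantiation word :: (type) monoid_add
begin

definition zero_word_def: "0 = Word []"

definition plus_word_def: "u + v = Word (letters u @ letters v)"

instance
  by standard (simp_all add: zero_word_def plus_word_def)

end

(* With concatenation of words as the (additively written) monoid operation, this is the free
   associative unital algebra on 'x; its ring structure comes from HOL-Library.Poly_Mapping. *)
type_synonym 'x free_algebra = "'x word \<Rightarrow>\<^sub>0 complex"

definition free_generator :: "'x \<Rightarrow> 'x free_algebra" where
  "free_generator x = Poly_Mapping.single (Word [x]) 1"

definition free_const :: "complex \<Rightarrow> 'x free_algebra" where
  "free_const c = Poly_Mapping.single 0 c"

datatype 'j chevalley = Gen_e 'j | Gen_f 'j | Gen_h 'j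

(* U(g^) is the free algebra modulo the two-sided ideal generated by these elements, g^ being the
   Lie algebra presented by the same generators and relations. *)
definition enveloping_relators :: "('j \<Rightarrow> 'j \<Rightarrow> int) \<Rightarrow> 'j chevalley free_algebra set" where
  "enveloping_relators C =
     chevalley_serre_relators (\<lambda>c p. free_const c * p) (\<lambda>p q. p * q - q * p) C
       (\<lambda>i. free_generator (Gen_e i)) (\<lambda>i. free_generator (Gen_f i))
       (\<lambda>i. free_generator (Gen_h i))"

(* A family pi of operators, one per generator, extends to the free algebra; the word
   x_1 ... x_n acts as the composite of pi x_1, ..., pi x_n, the last letter acting first. *)
definition free_action ::
  "(complex \<Rightarrow> 'v \<Rightarrow> 'v) \<Rightarrow> ('x \<Rightarrow> 'v \<Rightarrow> 'v) \<Rightarrow> 'x free_algebra \<Rightarrow> 'v \<Rightarrow> 'v::ab_group_add" where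
  "free_action scale \<pi> p v =
     (\<Sum>w\<in>Poly_Mapping.keys p. scale (Poly_Mapping.lookup p w) (foldr \<pi> (letters w) v))"

definition kac_moody_module ::
  "(complex \<Rightarrow> 'v \<Rightarrow> 'v) \<Rightarrow> ('j \<Rightarrow> 'j \<Rightarrow> int) \<Rightarrow> ('j chevalley \<Rightarrow> 'v \<Rightarrow> 'v::ab_group_add) \<Rightarrow> bool"
where
  "kac_moody_module scale C \<pi> \<longleftrightarrow>
     vector_space scale \<and> (\<forall>x. Vector_Spaces.linear scale scale (\<pi> x)) \<and>
     (\<forall>p\<in>enveloping_relators C. \<forall>v. free_action scale \<pi> p v = 0)"


section \<open>Verma modules\<close>

definition left_ideal_generated :: "'a::ring_1 set \<Rightarrow> 'a set" where
  "left_ideal_generated S =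
     \<Inter>{J. S \<subseteq> J \<and> 0 \<in> J \<and> (\<forall>x\<in>J. \<forall>y\<in>J. x + y \<in> J) \<and> (\<forall>p. \<forall>x\<in>J. p * x \<in> J)}"

(* The preimage in the free algebra of the left ideal of U(g^) generated by all e_i and all
   h_i - (Lambda | coroot_i); the right factors q account for the two-sided ideal of relations. *)
definition verma_ideal ::
  "('j \<Rightarrow> 'j \<Rightarrow> int) \<Rightarrow> ('j \<Rightarrow> complex) \<Rightarrow> 'j chevalley free_algebra set" where
  "verma_ideal C label =
     left_ideal_generated
       ({p * q |p q. p \<in> enveloping_relators C} \<union>
        {free_generator (Gen_e i) |i. True} \<union>
        {free_generator (Gen_h i) - free_const (label i) |i. True})"

(* The module is U(g^)/(left ideal above), with vac the class of 1. *)
definition is_verma_module ::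
  "(complex \<Rightarrow> 'v \<Rightarrow> 'v) \<Rightarrow> ('j \<Rightarrow> 'j \<Rightarrow> int) \<Rightarrow> ('j \<Rightarrow> complex) \<Rightarrow>
   ('j chevalley \<Rightarrow> 'v \<Rightarrow> 'v::ab_group_add) \<Rightarrow> 'v \<Rightarrow> bool" where
  "is_verma_module scale C label \<pi> vac \<longleftrightarrow>
     kac_moody_module scale C \<pi> \<and>
     (\<forall>v. \<exists>p. v = free_action scale \<pi> p vac) \<and>
     (\<forall>p. free_action scale \<pi> p vac = 0 \<longleftrightarrow> p \<in> verma_ideal C label)"

definition irreducible_module ::
  "(complex \<Rightarrow> 'v \<Rightarrow> 'v) \<Rightarrow> ('x \<Rightarrow> 'v \<Rightarrow> 'v::ab_group_add) \<Rightarrow> bool" where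
  "irreducible_module scale \<pi> \<longleftrightarrow>
     (\<exists>v::'v. v \<noteq> 0) \<and>
     (\<forall>W. module.subspace scale W \<and> (\<forall>x. \<forall>v\<in>W. \<pi> x v \<in> W) \<longrightarrow> W = {0} \<or> W = UNIV)"

definition generic_weight ::
  "(complex \<Rightarrow> 'v \<Rightarrow> 'v) \<Rightarrow> ('i option chevalley \<Rightarrow> 'v \<Rightarrow> 'v::ab_group_add) \<Rightarrow>
   ('i::finite option \<Rightarrow> 'i option \<Rightarrow> int) \<Rightarrow> ('i option \<Rightarrow> real) \<Rightarrow> ('i \<Rightarrow> nat) \<Rightarrow> 'i weight \<Rightarrow> bool"
where
  "generic_weight scale \<pi> C d a \<Lambda> \<longleftrightarrow>
     irreducible_module scale \<pi> \<and> (\<forall>\<beta>. \<beta> \<noteq> 0 \<longrightarrow> vertex_weight C d a \<Lambda> \<beta> \<noteq> 0)"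


section \<open>Completion and Whittaker vectors\<close>

definition simple_root :: "'j \<Rightarrow> 'j \<Rightarrow> nat" where
  "simple_root i = (\<lambda>j. if j = i then 1 else 0)"

(* fold applies the head of the list first: fold g [i_1, ..., i_N] vac = g i_N (... (g i_1 vac)) *)
definition f_monomial :: "('j chevalley \<Rightarrow> 'v \<Rightarrow> 'v) \<Rightarrow> 'v \<Rightarrow> 'j list \<Rightarrow> 'v" where
  "f_monomial \<pi> vac is = fold (\<lambda>i. \<pi> (Gen_f i)) is vac"

definition graded_piece ::
  "(complex \<Rightarrow> 'v \<Rightarrow> 'v) \<Rightarrow> ('j chevalley \<Rightarrow> 'v \<Rightarrow> 'v::ab_group_add) \<Rightarrow> 'v \<Rightarrow> ('j \<Rightarrow> nat) \<Rightarrow> 'v set"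
where
  "graded_piece scale \<pi> vac \<beta> =
     module.span scale {f_monomial \<pi> vac is |is. sum_list (map simple_root is) = \<beta>}"

(* the product of the graded pieces: w beta is the component of degree beta *)
definition completion ::
  "(complex \<Rightarrow> 'v \<Rightarrow> 'v) \<Rightarrow> ('j chevalley \<Rightarrow> 'v \<Rightarrow> 'v::ab_group_add) \<Rightarrow> 'v \<Rightarrow>
   (('j \<Rightarrow> nat) \<Rightarrow> 'v) set" where
  "completion scale \<pi> vac = {w. \<forall>\<beta>. w \<beta> \<in> graded_piece scale \<pi> vac \<beta>}"

(* e_i lowers the degree by alpha_i, and kills the pieces of degree beta with beta_i = 0 *)
definition completion_e ::
  "('j chevalley \<Rightarrow> 'v \<Rightarrow> 'v) \<Rightarrow> 'j \<Rightarrow> (('j \<Rightarrow> nat) \<Rightarrow> 'v) \<Rightarrow> ('j \<Rightarrow> nat) \<Rightarrow> 'v" where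
  "completion_e \<pi> i w = (\<lambda>\<beta>. \<pi> (Gen_e i) (w (\<beta> + simple_root i)))"

definition vac_functional ::
  "(complex \<Rightarrow> 'v \<Rightarrow> 'v) \<Rightarrow> 'v \<Rightarrow> (('j \<Rightarrow> nat) \<Rightarrow> 'v) \<Rightarrow> complex" where
  "vac_functional scale vac w = (THE c. w 0 = scale c vac)"

definition is_whittaker_vector ::
  "(complex \<Rightarrow> 'v \<Rightarrow> 'v) \<Rightarrow> ('j chevalley \<Rightarrow> 'v \<Rightarrow> 'v::ab_group_add) \<Rightarrow> 'v \<Rightarrow>
   ('j \<Rightarrow> complex) \<Rightarrow> (('j \<Rightarrow> nat) \<Rightarrow> 'v) \<Rightarrow> bool" where
  "is_whittaker_vector scale \<pi> vac \<mu> w \<longleftrightarrow>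
     w \<in> completion scale \<pi> vac \<and>
     vac_functional scale vac w = 1 \<and>
     (\<forall>i. completion_e \<pi> i w = (\<lambda>\<beta>. scale (\<mu> i) (w \<beta>)))"


section \<open>Paths\<close>

definition paths :: "('j \<Rightarrow> nat) \<Rightarrow> ('j \<Rightarrow> nat) list set" where
  "paths \<beta> = {p. p \<noteq> [] \<and> hd p = 0 \<and> last p = \<beta> \<and>
                 (\<forall>k. Suc k < length p \<longrightarrow> (\<exists>i. p ! Suc k = p ! k + simple_root i))}"

definition path_steps :: "('j \<Rightarrow> nat) list \<Rightarrow> 'j list" where
  "path_steps p = map (\<lambda>k. THE i. p ! Suc k = p ! k + simple_root i) [0..<length p - 1]"

definition path_vector ::
  "('j chevalley \<Rightarrow> 'v \<Rightarrow> 'v) \<Rightarrow> 'v \<Rightarrow> ('j \<Rightarrow> nat) list \<Rightarrow> 'v" where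
  "path_vector \<pi> vac p = f_monomial \<pi> vac (path_steps p)"

definition path_weight :: "(('j \<Rightarrow> nat) \<Rightarrow> complex) \<Rightarrow> ('j \<Rightarrow> nat) list \<Rightarrow> complex" where
  "path_weight v p = (\<Prod>k\<in>{1..<length p}. 1 / v (p ! k))"

definition Z_vector ::
  "(complex \<Rightarrow> 'v \<Rightarrow> 'v) \<Rightarrow> ('j chevalley \<Rightarrow> 'v \<Rightarrow> 'v::ab_group_add) \<Rightarrow> 'v \<Rightarrow>
   (('j \<Rightarrow> nat) \<Rightarrow> complex) \<Rightarrow> ('j \<Rightarrow> nat) \<Rightarrow> 'v" where
  "Z_vector scale \<pi> vac v \<beta> = (\<Sum>p\<in>paths \<beta>. scale (path_weight v p) (path_vector \<pi> vac p))"

(* a path in degree beta has exactly (sum of the coefficients of beta) + 1 vertices, all of them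
   bounded by beta, so the sum in Z_vector is a genuine finite sum *)
lemma finite_paths: "finite (paths (\<beta> :: 'j::finite \<Rightarrow> nat))"
proof -
  have vertex: "p ! k \<le> \<beta> \<and> k \<le> (\<Sum>j\<in>UNIV. (p ! k) j)" if "p \<in> paths \<beta>" "k < length p" for p k
  proof -
    from that have p: "p \<noteq> []" "hd p = 0" "last p = \<beta>"
      and st: "\<And>k. Suc k < length p \<Longrightarrow> \<exists>i. p ! Suc k = p ! k + simple_root i"
      by (auto simp: paths_def)
    have "k \<le> (\<Sum>j\<in>UNIV. (p ! k) j)" using that(2)
    proof (induction k)
      case (Suc k)
      then obtain i where i: "p ! Suc k = p ! k + simple_root i" using st by blast
      have "(\<Sum>j\<in>UNIV. (p ! Suc k) j) = (\<Sum>j\<in>UNIV. (p ! k) j) + 1"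
        by (simp add: i sum.distrib simple_root_def)
      with Suc show ?case by simp
    qed simp
    moreover have "p ! k \<le> p ! (length p - 1)"
    proof -
      have "k + m < length p \<Longrightarrow> p ! k \<le> p ! (k + m)" for m
      proof (induction m)
        case (Suc m)
        then obtain i where "p ! Suc (k + m) = p ! (k + m) + simple_root i"
          using st[of "k + m"] by auto
        then have "p ! (k + m) \<le> p ! (k + Suc m)" by (simp add: le_fun_def)
        moreover have "p ! k \<le> p ! (k + m)" using Suc by simp
        ultimately show ?case by (rule order_trans[rotated])
      qed simp
      from this[of "length p - 1 - k"] that(2) show ?thesis by simp
    qed
    ultimately show ?thesis using p by (simp add: last_conv_nth)
  qed
  have "finite {\<gamma> :: 'j \<Rightarrow> nat. \<gamma> \<le> \<beta>}"
  proof (rule finite_subset)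
    show "{\<gamma>. \<gamma> \<le> \<beta>} \<subseteq> {\<gamma>. \<forall>i. (i \<in> UNIV \<longrightarrow> \<gamma> i \<in> {..sum \<beta> UNIV}) \<and> (i \<notin> UNIV \<longrightarrow> \<gamma> i = 0)}"
      using member_le_sum[of _ UNIV \<beta>] by (auto simp: le_fun_def intro: order_trans)
  qed (intro finite_set_of_finite_funs; simp)
  then have "finite {p. set p \<subseteq> {\<gamma>. \<gamma> \<le> \<beta>} \<and> length p \<le> Suc (sum \<beta> UNIV)}"
    by (rule finite_lists_length_le)
  moreover have "paths \<beta> \<subseteq> {p. set p \<subseteq> {\<gamma>. \<gamma> \<le> \<beta>} \<and> length p \<le> Suc (sum \<beta> UNIV)}"
  proof safe
    fix p assume p: "p \<in> paths \<beta>"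
    show "\<gamma> \<le> \<beta>" if "\<gamma> \<in> set p" for \<gamma>
      using vertex[OF p] that by (auto simp: in_set_conv_nth)
    have "p \<noteq> []" "last p = \<beta>" using p by (auto simp: paths_def)
    then show "length p \<le> Suc (sum \<beta> UNIV)"
      using vertex[OF p, of "length p - 1"] by (simp add: last_conv_nth)
  qed
  ultimately show ?thesis by (rule rev_finite_subset)
qed

end

(* Write v for the vertex weight and Z_b for the path sum.  Splitting off the last step of a path gives
   v(b) Z_b = sum_i f_i Z_(b - alpha_i).  Apply e_j: since [e_j, f_i] = delta_ij h_j and
   v(b) - v(b - alpha_j) = d_j (Lambda - b + alpha_j | coroot_j), induction on b yields
   e_j Z_b = (1 / d_j) Z_(b - alpha_j), which is the Whittaker condition after rescaling.

   For uniqueness, a lowest nonzero component of the difference of two Whittaker vectors is a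
   singular vector of nonzero degree; by irreducibility the submodule it generates contains the
   vacuum, although it lies in the span of the pieces of nonzero degree.  The h_i do not separate
   degrees that differ by multiples of delta, so these pieces are separated from the vacuum by an
   operator that comes from rescaling the generators. *)
theory Submission
  imports Defs
begin

section \<open>The free associative algebra acting on a vector space\<close>

section \<open>Operators indexed by generators\<close>

text \<open>A finitely supported function arises by setting fresh keys one at a time, and setting a
  fresh key is adding a monomial. Additive statements about the free algebra thereby reduce to
  single words.\<close>

lemma free_algebra_induct [case_names zero add]:
  fixes p :: "'y free_algebra"
  assumes "P 0" and "\<And>p w c. P p \<Longrightarrow> P (p + Poly_Mapping.single w c)"
  shows "P p"
proof (induction p rule: update_induct)
  case const
  show ?case by (rule assms(1))
next
  case (update p w c)
  have "Poly_Mapping.update w c p = p + Poly_Mapping.single w c"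
    using update(1) by (intro poly_mapping_eqI)
      (auto simp: lookup_update lookup_add lookup_single in_keys_iff when_def)
  then show ?case using assms(2)[OF update(3)] by simp
qed

text \<open>No relations are imposed on \<pi>: the twisted family is first interpreted here and only
  then shown to satisfy the relations.\<close>

locale operator_family = vector_space scale
  for scale :: "complex \<Rightarrow> 'v::ab_group_add \<Rightarrow> 'v" +
  fixes \<pi> :: "'x \<Rightarrow> 'v \<Rightarrow> 'v"
  assumes linear_op: "Vector_Spaces.linear scale scale (\<pi> x)"
begin

abbreviation act :: "'x free_algebra \<Rightarrow> 'v \<Rightarrow> 'v" where
  "act \<equiv> free_action scale \<pi>"

lemma op_add: "\<pi> x (u + v) = \<pi> x u + \<pi> x v"
  and op_scale: "\<pi> x (scale c v) = scale c (\<pi> x v)"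
  using linear_op by (auto simp: Vector_Spaces.linear_iff)

lemma op_zero [simp]: "\<pi> x 0 = 0"
  using op_scale[of x 0 0] by simp

lemma op_diff: "\<pi> x (u - v) = \<pi> x u - \<pi> x v"
  using op_add[of x "u - v" v] by simp

lemma op_sum: "\<pi> x (sum g A) = (\<Sum>i\<in>A. \<pi> x (g i))"
  by (induction A rule: infinite_finite_induct) (auto simp: op_add)

lemma op_span:
  assumes "v \<in> span S" and "\<And>s. s \<in> S \<Longrightarrow> \<pi> x s \<in> span R"
  shows "\<pi> x v \<in> span R"
  using assms(1)
proof (induction rule: span_induct_alt)
  case base
  show ?case by (simp add: span_zero)
next
  case (step c s u)
  from span_add[OF span_scale[OF assms(2)[OF step(1)], of c] step(2)] show ?case
    by (simp only: op_add op_scale)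
qed

lemma foldr_op_add: "foldr \<pi> xs (u + v) = foldr \<pi> xs u + foldr \<pi> xs v"
  by (induction xs) (auto simp: op_add)

lemma foldr_op_scale: "foldr \<pi> xs (scale c v) = scale c (foldr \<pi> xs v)"
  by (induction xs) (auto simp: op_scale)

text \<open>Keys can disappear by cancellation in a sum, so p, q and p + q are compared over a
  common finite superset.\<close>

lemma act_superset:
  assumes "finite S" "Poly_Mapping.keys p \<subseteq> S"
  shows "act p v = (\<Sum>w\<in>S. scale (Poly_Mapping.lookup p w) (foldr \<pi> (letters w) v))"
  unfolding free_action_def
  by (rule sum.mono_neutral_left) (use assms in \<open>auto simp: in_keys_iff\<close>)

lemma act_zero [simp]: "act 0 v = 0"
  by (simp add: free_action_def)

lemma act_add: "act (p + q) v = act p v + act q v"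
proof -
  let ?S = "Poly_Mapping.keys p \<union> Poly_Mapping.keys q"
  have "Poly_Mapping.keys (p + q) \<subseteq> ?S" by (rule Poly_Mapping.keys_add)
  then show ?thesis
    by (simp add: act_superset[where S = ?S] lookup_add scale_left_distrib sum.distrib)
qed

lemma act_diff: "act (p - q) v = act p v - act q v"
  using act_add[of "p - q" q v] by simp

lemma act_single: "act (Poly_Mapping.single w c) v = scale c (foldr \<pi> (letters w) v)"
  by (subst act_superset[where S = "{w}"]) auto

lemma act_generator [simp]: "act (free_generator x) v = \<pi> x v"
  by (simp add: free_generator_def act_single)

lemma act_const [simp]: "act (free_const c) v = scale c v"
  by (simp add: free_const_def act_single zero_word_def)

lemma act_one [simp]: "act 1 v = v"
  using act_const[of 1 v] by (simp add: free_const_def)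

lemma act_add_vec: "act p (u + v) = act p u + act p v"
  by (simp add: free_action_def foldr_op_add scale_right_distrib sum.distrib)

lemma act_scale_vec: "act p (scale c v) = scale c (act p v)"
  by (simp add: free_action_def foldr_op_scale scale_sum_right mult.commute)

lemma act_zero_vec [simp]: "act p 0 = 0"
  using act_scale_vec[of p 0 0] by simp

lemma act_mult: "act (p * q) v = act p (act q v)"
proof (induction p rule: free_algebra_induct)
  case (add p w c)
  have "act (Poly_Mapping.single w c * q) v = act (Poly_Mapping.single w c) (act q v)"
  proof (induction q rule: free_algebra_induct)
    case (add q w' c')
    then show ?case
      by (simp add: distrib_left act_add act_add_vec mult_single act_single foldr_op_scale
          plus_word_def)
  qed simp
  with add show ?case by (simp add: distrib_right act_add)
qed simp

end


section \<open>Commutation rules of the Chevalley generators\<close>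

section \<open>Modules over the enveloping algebra\<close>

locale kac_moody_rep = operator_family scale \<pi>
  for scale :: "complex \<Rightarrow> 'v::ab_group_add \<Rightarrow> 'v" and \<pi> :: "'j chevalley \<Rightarrow> 'v \<Rightarrow> 'v" +
  fixes C :: "'j \<Rightarrow> 'j \<Rightarrow> int"
  assumes act_relator: "p \<in> enveloping_relators C \<Longrightarrow> act p v = 0"
begin

abbreviation "E i \<equiv> \<pi> (Gen_e i)"
abbreviation "F i \<equiv> \<pi> (Gen_f i)"
abbreviation "H i \<equiv> \<pi> (Gen_h i)"

lemma H_F: "H i (F j v) = F j (H i v) - scale (of_int (C j i)) (F j v)"
proof -
  have "free_generator (Gen_h i) * free_generator (Gen_f j)
      - free_generator (Gen_f j) * free_generator (Gen_h i)
      + free_const (of_int (C j i)) * free_generator (Gen_f j) \<in> enveloping_relators C"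
    unfolding enveloping_relators_def chevalley_serre_relators_def by blast
  from act_relator[OF this, of v] show ?thesis
    by (simp add: act_add act_diff act_mult algebra_simps)
qed

lemma E_F: "E i (F j v) = F j (E i v) + (if i = j then H i v else 0)"
proof -
  have "free_generator (Gen_e i) * free_generator (Gen_f j)
      - free_generator (Gen_f j) * free_generator (Gen_e i)
      - (if i = j then free_generator (Gen_h j) else 0) \<in> enveloping_relators C"
    unfolding enveloping_relators_def chevalley_serre_relators_def by blast
  from act_relator[OF this, of v] show ?thesis
    by (simp add: act_add act_diff act_mult algebra_simps split: if_splits)
qed

text \<open>The annihilator of v is one of the left ideals intersected in
  \<open>left_ideal_generated\<close>; relators kill every vector, hence also after a right factor
  q. This universal property of the Verma module is applied later to the twisted action.\<close>

lemma verma_ideal_annihilates: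
  assumes "\<And>i. E i v = 0" and "\<And>i. H i v = scale (label i) v" and "p \<in> verma_ideal C label"
  shows "act p v = 0"
proof -
  have "p \<in> {p. act p v = 0}"
    using assms(3) unfolding verma_ideal_def left_ideal_generated_def
    by (rule InterD)
      (use assms(1,2) in \<open>auto simp: act_mult act_add act_diff act_relator\<close>)
  then show ?thesis by simp
qed

end

lemma kac_moody_rep_iff: "kac_moody_rep scale \<pi> C \<longleftrightarrow> kac_moody_module scale C \<pi>"
  unfolding kac_moody_rep_def kac_moody_module_def operator_family_def operator_family_axioms_def
    kac_moody_rep_axioms_def by blast

section \<open>Rescaling by the principal grading\<close>

fun twist_factor :: "'j chevalley \<Rightarrow> complex" where
  "twist_factor (Gen_e i) = 1 / 2"
| "twist_factor (Gen_f i) = 2"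
| "twist_factor (Gen_h i) = 1"

text \<open>A generator of principal degree n is multiplied by 2^(-n). The base 2 is not a root of
  unity, so it separates degree 0 from all others.\<close>

definition twist :: "(complex \<Rightarrow> 'v \<Rightarrow> 'v) \<Rightarrow> ('j chevalley \<Rightarrow> 'v \<Rightarrow> 'v) \<Rightarrow> 'j chevalley \<Rightarrow> 'v \<Rightarrow> 'v"
  where "twist scale \<pi> x v = scale (twist_factor x) (\<pi> x v)"

text \<open>The relators are homogeneous for the principal grading, so rescaling the generators by the
  character of that grading preserves the relations.\<close>

lemma (in kac_moody_rep) kac_moody_rep_twist: "kac_moody_rep scale (twist scale \<pi>) C"
proof -
  have "Vector_Spaces.linear scale scale (twist scale \<pi> x)" for x
    unfolding Vector_Spaces.linear_iff
    by (simp add: twist_def op_add op_scale scale_right_distrib vector_space_axioms mult.commute)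
  then interpret tw: operator_family scale "twist scale \<pi>"
    by (intro operator_family.intro operator_family_axioms.intro vector_space_axioms)
  \<comment> \<open>The number c plays the role of a degree: it is multiplicative on products and
    shared by the terms of a sum. The element 0 has every degree, which covers the case i \<noteq> j
    of [e_i, f_j].\<close>
  define homog where "homog p c \<longleftrightarrow> (\<forall>v. tw.act p v = scale c (act p v))" for p c
  have gen: "homog (free_generator x) (twist_factor x)" for x
    by (simp add: homog_def twist_def)
  have const: "homog (free_const b) 1" for b
    by (simp add: homog_def)
  have zero: "homog 0 c" for c
    by (simp add: homog_def)
  have diff: "homog p c \<Longrightarrow> homog q c \<Longrightarrow> homog (p - q) c" for p q c
    by (simp add: homog_def act_diff tw.act_diff scale_right_diff_distrib)
  have add: "homog p c \<Longrightarrow> homog q c \<Longrightarrow> homog (p + q) c" for p q c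
    by (simp add: homog_def act_add tw.act_add scale_right_distrib)
  have mult: "homog p b \<Longrightarrow> homog q c \<Longrightarrow> homog (p * q) (b * c)" for p q b c
    by (simp add: homog_def act_mult tw.act_mult act_scale_vec)
  have br: "homog (p * q - q * p) (b * c)" if "homog p b" "homog q c" for p q b c
    using mult[OF that] mult[OF that(2,1)] by (intro diff) (simp_all add: mult.commute)
  have pow: "homog (((\<lambda>q. p * q - q * p) ^^ n) q) (b ^ n * c)" if "homog p b" "homog q c"
    for p q b c n
  proof (induction n)
    case (Suc n)
    from br[OF that(1) this] show ?case by (simp add: mult.assoc)
  qed (simp add: that)
  have "\<exists>c. homog p c" if "p \<in> enveloping_relators C" for p
  proof -
    have hh: "homog (free_generator (Gen_h i) * free_generator (Gen_h j)
        - free_generator (Gen_h j) * free_generator (Gen_h i)) 1" for i j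
      using br[OF gen gen, of "Gen_h i" "Gen_h j"] by simp
    have he: "homog (free_generator (Gen_h i) * free_generator (Gen_e j)
        - free_generator (Gen_e j) * free_generator (Gen_h i) - free_const b * free_generator (Gen_e j))
         (1 / 2)" for i j b
      by (rule diff)
        (use br[OF gen gen, of "Gen_h i" "Gen_e j"] mult[OF const gen, of b "Gen_e j"] in simp_all)
    have hf: "homog (free_generator (Gen_h i) * free_generator (Gen_f j)
        - free_generator (Gen_f j) * free_generator (Gen_h i) + free_const b * free_generator (Gen_f j))
         2" for i j b
      by (rule add)
        (use br[OF gen gen, of "Gen_h i" "Gen_f j"] mult[OF const gen, of b "Gen_f j"] in simp_all)
    have ef: "homog (free_generator (Gen_e i) * free_generator (Gen_f j)
        - free_generator (Gen_f j) * free_generator (Gen_e i)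
        - (if i = j then free_generator (Gen_h j) else 0)) 1" for i j
      by (rule diff)
        (use br[OF gen gen, of "Gen_e i" "Gen_f j"] gen[of "Gen_h j"] zero in simp_all)
    from that show ?thesis
      unfolding enveloping_relators_def chevalley_serre_relators_def
      using hh he hf ef pow[OF gen gen] by blast
  qed
  then have "tw.act p v = 0" if "p \<in> enveloping_relators C" for p v
    using that act_relator[OF that] unfolding homog_def by (metis scale_zero_right)
  then show ?thesis by unfold_locales
qed


section \<open>Weights, degrees and monomials in the f_i\<close>

section \<open>Highest weight vectors\<close>

lemma f_monomial_snoc: "f_monomial \<pi> v (is @ [i]) = \<pi> (Gen_f i) (f_monomial \<pi> v is)"
  and f_monomial_Nil: "f_monomial \<pi> v [] = v"
  by (simp_all add: f_monomial_def)

locale highest_weight_rep = kac_moody_rep scale \<pi> C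
  for scale :: "complex \<Rightarrow> 'v::ab_group_add \<Rightarrow> 'v" and \<pi> :: "'j::finite chevalley \<Rightarrow> 'v \<Rightarrow> 'v"
    and C :: "'j \<Rightarrow> 'j \<Rightarrow> int" +
  fixes label :: "'j \<Rightarrow> complex" and vac :: 'v
  assumes E_vac: "E i vac = 0" and H_vac: "H i vac = scale (label i) vac"
begin

abbreviation piece :: "('j \<Rightarrow> nat) \<Rightarrow> 'v set" where
  "piece \<equiv> graded_piece scale \<pi> vac"

text \<open>This is (\<Lambda> - \<beta> | coroot_i) when \<open>label i\<close> is (\<Lambda> |
  coroot_i).\<close>

definition piece_weight :: "('j \<Rightarrow> nat) \<Rightarrow> 'j \<Rightarrow> complex" where
  "piece_weight \<beta> i = label i - (\<Sum>j\<in>UNIV. of_nat (\<beta> j) * of_int (C j i))"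

lemma piece_weight_add:
  "piece_weight (\<beta> + simple_root j) i = piece_weight \<beta> i - of_int (C j i)"
proof -
  have "(\<Sum>k\<in>UNIV. of_nat (simple_root j k) * of_int (C k i) :: complex)
      = (\<Sum>k\<in>UNIV. if k = j then of_int (C k i) else 0)"
    by (rule sum.cong) (auto simp: simple_root_def)
  then show ?thesis
    by (simp add: piece_weight_def distrib_right sum.distrib)
qed

text \<open>Serves an arbitrary singular vector v in \<open>singular_generates\<close>, where only
  the stability of the line matters.\<close>

lemma H_f_monomial:
  assumes "H i v = scale c v"
  shows "\<exists>b. H i (f_monomial \<pi> v is) = scale b (f_monomial \<pi> v is)"
proof (induction "is" rule: rev_induct)
  case Nil
  show ?case using assms by (auto simp: f_monomial_Nil)
next
  case (snoc j js)
  then obtain b where "H i (f_monomial \<pi> v js) = scale b (f_monomial \<pi> v js)" by blast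
  then have "H i (f_monomial \<pi> v (js @ [j])) = scale (b - of_int (C j i)) (f_monomial \<pi> v (js @ [j]))"
    by (simp add: f_monomial_snoc H_F op_scale scale_left_diff_distrib)
  then show ?case by blast
qed

lemma H_f_monomial_vac:
  "H i (f_monomial \<pi> vac is)
     = scale (piece_weight (sum_list (map simple_root is)) i) (f_monomial \<pi> vac is)"
proof (induction "is" rule: rev_induct)
  case Nil
  show ?case by (simp add: f_monomial_Nil H_vac piece_weight_def)
next
  case (snoc j js)
  have "piece_weight (sum_list (map simple_root (js @ [j]))) i
      = piece_weight (sum_list (map simple_root js)) i - of_int (C j i)"
    using piece_weight_add[of "sum_list (map simple_root js)" j i] by simp
  with snoc show ?case
    by (simp only: f_monomial_snoc H_F op_scale scale_left_diff_distrib)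
qed

lemma H_piece:
  assumes "v \<in> piece \<beta>"
  shows "H i v = scale (piece_weight \<beta> i) v"
  using assms unfolding graded_piece_def
proof (induction rule: span_induct_alt)
  case (step c x y)
  then show ?case by (auto simp: op_add op_scale H_f_monomial_vac scale_right_distrib mult.commute)
qed simp

text \<open>A monomial without f_i commutes with e_i, which therefore reaches the vacuum and kills
  it. The condition through \<open>completion_e\<close> is shifted by \<alpha>_i and is silent about
  such degrees, so uniqueness needs this case separately.\<close>

lemma E_piece_eq_0:
  assumes "v \<in> piece \<beta>" "\<beta> i = 0"
  shows "E i v = 0"
proof -
  have mono: "sum_list (map simple_root is) i = 0 \<Longrightarrow> E i (f_monomial \<pi> vac is) = 0" for "is"
  proof (induction "is" rule: rev_induct)
    case Nil
    show ?case by (simp add: f_monomial_Nil E_vac)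
  next
    case (snoc j js)
    then show ?case by (auto simp: f_monomial_snoc E_F simple_root_def split: if_splits)
  qed
  from assms(1) show ?thesis unfolding graded_piece_def
  proof (induction rule: span_induct_alt)
    case (step c x y)
    then show ?case using mono assms(2) by (auto simp: op_add op_scale)
  qed simp
qed

lemma sum_list_simple_root_eq_0: "sum_list (map simple_root is) = (0 :: 'j \<Rightarrow> nat) \<longleftrightarrow> is = []"
proof (cases "is")
  case (Cons i js)
  have "sum_list (map simple_root is) i \<noteq> (0 :: nat)"
    by (simp add: Cons simple_root_def del: sum_list_eq_0_iff)
  then show ?thesis using Cons by (metis list.distinct(1) zero_fun_apply)
qed simp

lemma piece_0: "piece 0 = span {vac}"
  by (simp add: graded_piece_def sum_list_simple_root_eq_0 f_monomial_Nil del: sum_list_eq_0_iff)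

text \<open>The sum of all pieces of nonzero degree; that it is complementary to the vacuum has to
  be proved.\<close>

definition lower :: "'v set" where
  "lower = span {f_monomial \<pi> vac is |is. is \<noteq> []}"

lemma piece_subset_lower: "\<beta> \<noteq> 0 \<Longrightarrow> piece \<beta> \<subseteq> lower"
  unfolding lower_def graded_piece_def
  by (rule span_mono) auto

lemma F_lower:
  assumes "v \<in> lower"
  shows "F i v \<in> lower"
  using assms unfolding lower_def
proof (rule op_span)
  fix s assume "s \<in> {f_monomial \<pi> vac is |is. is \<noteq> []}"
  then obtain js where "s = f_monomial \<pi> vac js" by blast
  then show "F i s \<in> span {f_monomial \<pi> vac is |is. is \<noteq> []}"
    by (intro span_base CollectI exI[of _ "js @ [i]"]) (simp add: f_monomial_snoc)
qed

lemma f_monomial_lower: "v \<in> lower \<Longrightarrow> f_monomial \<pi> v is \<in> lower"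
  by (induction "is" rule: rev_induct) (auto simp: f_monomial_Nil f_monomial_snoc F_lower)

text \<open>Moving e_i to the right past the f_j leaves only terms with some h_i, which rescales the
  monomial it meets. Hence the f-monomials on v already span a submodule.\<close>

lemma singular_generates:
  assumes E: "\<And>i. E i v = 0" and H: "\<And>i. H i v = scale (c i) v"
  defines "W \<equiv> span (range (f_monomial \<pi> v))"
  assumes "w \<in> W"
  shows "\<pi> x w \<in> W"
proof -
  have F_W: "F i (f_monomial \<pi> v is) \<in> W" for i "is"
    unfolding W_def by (rule span_base) (metis f_monomial_snoc rangeI)
  have H_W: "H i (f_monomial \<pi> v is) \<in> W" for i "is"
    using H_f_monomial[OF H[of i], of "is"] unfolding W_def
    by (metis rangeI span_base span_scale)
  have F_stable: "F i w \<in> W" if "w \<in> W" for i w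
    using that unfolding W_def by (rule op_span) (use F_W in \<open>auto simp: W_def\<close>)
  have E_W: "E i (f_monomial \<pi> v is) \<in> W" for i "is"
  proof (induction "is" rule: rev_induct)
    case Nil
    show ?case by (simp add: f_monomial_Nil E W_def span_zero)
  next
    case (snoc j js)
    have "(if i = j then H i (f_monomial \<pi> v js) else 0) \<in> W"
      using H_W by (simp add: W_def span_zero)
    from span_add[OF F_stable[OF snoc, unfolded W_def] this[unfolded W_def]] show ?case
      by (simp only: f_monomial_snoc E_F W_def)
  qed
  have gen: "\<pi> x (f_monomial \<pi> v is) \<in> W" for "is"
    by (cases x) (simp_all add: E_W F_W H_W)
  show ?thesis
    using assms(4) unfolding W_def by (rule op_span) (use gen in \<open>auto simp: W_def\<close>)
qed

end


section \<open>Singular vectors in an irreducible Verma module\<close>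

section \<open>Verma modules\<close>

locale verma_rep = highest_weight_rep +
  assumes vac_generates: "\<exists>p. v = act p vac"
    and act_vac_eq_0: "act p vac = 0 \<Longrightarrow> p \<in> verma_ideal C label"
begin

text \<open>The Verma ideal also annihilates the vacuum in the twisted module, so sending p vac to
  its twisted counterpart is well defined. T acts like 2 to the power of the height and replaces the
  derivation, which is not among the Chevalley generators.\<close>

lemma twist_operator:
  obtains T where "Vector_Spaces.linear scale scale T" "T vac = vac"
    "\<And>i v. T (F i v) = scale 2 (F i (T v))"
proof -
  interpret tw: kac_moody_rep scale "twist scale \<pi>" C by (rule kac_moody_rep_twist)
  have tw_eq: "tw.act p vac = tw.act q vac" if "act p vac = act q vac" for p q
  proof -
    have "p - q \<in> verma_ideal C label"
      by (rule act_vac_eq_0) (simp add: act_diff that)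
    then have "tw.act (p - q) vac = 0"
      by (rule tw.verma_ideal_annihilates[rotated 2]) (simp_all add: twist_def E_vac H_vac)
    then show ?thesis by (simp add: tw.act_diff)
  qed
  define T where "T v = tw.act (SOME p. v = act p vac) vac" for v
  have T: "T (act p vac) = tw.act p vac" for p
    unfolding T_def by (rule tw_eq) (rule someI2[of _ p]; simp)
  have T_add: "T (u + v) = T u + T v" for u v
  proof -
    obtain p q where "u = act p vac" "v = act q vac" using vac_generates by metis
    then show ?thesis using T[of "p + q"] by (simp add: T act_add tw.act_add)
  qed
  have T_scale: "T (scale c v) = scale c (T v)" for c v
  proof -
    obtain p where "v = act p vac" using vac_generates by metis
    then show ?thesis using T[of "free_const c * p"] by (simp add: T act_mult tw.act_mult)
  qed
  show ?thesis
  proof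
    show "Vector_Spaces.linear scale scale T"
      unfolding Vector_Spaces.linear_iff by (simp add: T_add T_scale vector_space_axioms)
    show "T vac = vac" using T[of 1] by simp
    show "T (F i v) = scale 2 (F i (T v))" for i v
    proof -
      obtain p where "v = act p vac" using vac_generates by metis
      then show ?thesis
        using T[of "free_generator (Gen_f i) * p"]
        by (simp add: T act_mult tw.act_mult twist_def)
    qed
  qed
qed

text \<open>The monomials are eigenvectors of the twist operator, with eigenvalue a power of 2 given by the
  length; powers of 2 with positive exponent are eliminated one at a time.\<close>

lemma vac_notin_lower:
  assumes "vac \<noteq> 0"
  shows "vac \<notin> lower"
proof -
  obtain T where lin: "Vector_Spaces.linear scale scale T" and T_vac: "T vac = vac"
    and T_F: "\<And>i v. T (F i v) = scale 2 (F i (T v))"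
    by (rule twist_operator) blast
  have T_add: "T (u + v) = T u + T v" and T_scale: "T (scale c v) = scale c (T v)" for u v c
    using lin by (auto simp: Vector_Spaces.linear_iff)
  have T_mono: "T (f_monomial \<pi> vac is) = scale (2 ^ length is) (f_monomial \<pi> vac is)" for "is"
    by (induction "is" rule: rev_induct)
      (auto simp: f_monomial_Nil f_monomial_snoc T_vac T_F op_scale)
  define A where "A N = span {f_monomial \<pi> vac is |is. is \<noteq> [] \<and> length is \<le> N}" for N
  have A_0: "0 \<in> A N" and A_add: "u \<in> A N \<Longrightarrow> v \<in> A N \<Longrightarrow> u + v \<in> A N"
    and A_scale: "u \<in> A N \<Longrightarrow> scale c u \<in> A N" for N u v c
    unfolding A_def by (rule span_zero, erule (1) span_add, erule span_scale)
  have A_base: "f_monomial \<pi> vac is \<in> A N" if "is \<noteq> []" "length is \<le> N" for N "is"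
    unfolding A_def by (rule span_base) (use that in blast)
  \<comment> \<open>T - 2^(N+1) kills the monomials of length N+1 and rescales the shorter ones, so
    it lowers the filtration by length.\<close>
  have A_step: "T v - scale (2 ^ Suc N) v \<in> A N" if "v \<in> A (Suc N)" for v N
    using that unfolding A_def[of "Suc N"]
  proof (induction rule: span_induct_alt)
    case base
    show ?case using T_scale[of 0 0] by (simp add: A_0)
  next
    case (step c x y)
    let ?D = "\<lambda>v. T v - scale (2 ^ Suc N) v"
    from step obtain js where js: "x = f_monomial \<pi> vac js" "js \<noteq> []" "length js \<le> Suc N" by blast
    have "?D x \<in> A N"
    proof (cases "length js = Suc N")
      case True
      then show ?thesis by (simp add: js(1) T_mono A_0)
    next
      case False
      with js have "x \<in> A N" using A_base[of js N] by simp
      moreover have "?D x = scale (2 ^ length js - 2 ^ Suc N) x"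
        by (simp add: js(1) T_mono scale_left_diff_distrib)
      ultimately show ?thesis by (simp only: A_scale)
    qed
    then have "scale c (?D x) + ?D y \<in> A N" by (intro A_add A_scale step)
    moreover have "?D (scale c x + y) = scale c (?D x) + ?D y"
      by (simp add: T_add T_scale scale_right_distrib scale_right_diff_distrib
          scale_left_commute[of c])
    ultimately show ?case by (simp only:)
  qed
  have vac_A: "vac \<notin> A N" for N
  proof (induction N)
    case 0
    have "A 0 = span {}" unfolding A_def by (rule arg_cong[of _ _ span]) auto
    then show ?case using assms by simp
  next
    case (Suc N)
    show ?case
    proof
      assume "vac \<in> A (Suc N)"
      \<comment> \<open>T fixes the vacuum, so a nonzero multiple of the vacuum survives one level
        further down.\<close>
      from A_step[OF this] have "scale (1 - 2 ^ Suc N) vac \<in> A N"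
        by (simp add: T_vac scale_left_diff_distrib)
      moreover have "(1 - 2 ^ Suc N :: complex) \<noteq> 0"
      proof
        assume "(1 - 2 ^ Suc N :: complex) = 0"
        then have "(of_nat (2 ^ Suc N) :: complex) = of_nat 1" by simp
        then have "(2 :: nat) ^ Suc N = 1" using of_nat_eq_iff by blast
        then show False by simp
      qed
      ultimately have "vac \<in> A N"
        using A_scale[of "scale (1 - 2 ^ Suc N) vac" N "inverse (1 - 2 ^ Suc N)"] by simp
      with Suc show False by simp
    qed
  qed
  have "\<exists>N. v \<in> A N" if "v \<in> lower" for v
    using that unfolding lower_def
  proof (induction rule: span_induct_alt)
    case base
    show ?case using A_0 by blast
  next
    case (step c x y)
    then obtain N js where N: "y \<in> A N" and js: "x = f_monomial \<pi> vac js" "js \<noteq> []" by blast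
    have "A N \<subseteq> A (max N (length js))"
      unfolding A_def by (rule span_mono) auto
    with N have "y \<in> A (max N (length js))" by blast
    moreover have "x \<in> A (max N (length js))" unfolding js(1) using js(2) by (intro A_base) auto
    ultimately show ?case by (intro exI[of _ "max N (length js)"] A_add A_scale)
  qed
  with vac_A show ?thesis by blast
qed

text \<open>The submodule generated by v is spanned by f-monomials on v, so it stays in
  \<open>lower\<close> and misses the vacuum; irreducibility forces it to be zero.\<close>

lemma singular_vector_eq_0:
  assumes irr: "irreducible_module scale \<pi>" and vac: "vac \<noteq> 0"
    and v: "v \<in> piece \<beta>" "\<beta> \<noteq> 0" "\<And>i. E i v = 0"
  shows "v = 0"
proof (rule ccontr)
  assume "v \<noteq> 0"
  let ?W = "span (range (f_monomial \<pi> v))"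
  have "v \<in> ?W" by (rule span_base) (metis f_monomial_Nil rangeI)
  moreover have "\<And>x w. w \<in> ?W \<Longrightarrow> \<pi> x w \<in> ?W"
    by (rule singular_generates[OF v(3) H_piece[OF v(1)]])
  then have "?W = {0} \<or> ?W = UNIV"
    using irr subspace_span unfolding irreducible_module_def by blast
  ultimately have "?W = UNIV" using \<open>v \<noteq> 0\<close> by auto
  moreover have "?W \<subseteq> lower"
  proof -
    have "v \<in> lower" using v piece_subset_lower by blast
    then have "range (f_monomial \<pi> v) \<subseteq> lower" using f_monomial_lower by blast
    then show ?thesis unfolding lower_def by (rule span_minimal) simp
  qed
  ultimately show False using vac_notin_lower[OF vac] by blast
qed

end


section \<open>Path sums and their last-step recursion\<close>

section \<open>Sums over paths\<close>

lemma simple_root_inject: "simple_root i = (simple_root j :: 'j \<Rightarrow> nat) \<longleftrightarrow> i = j"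
  by (auto simp: simple_root_def fun_eq_iff split: if_splits)

lemma diff_simple_root_add: "\<beta> i \<noteq> 0 \<Longrightarrow> \<beta> - simple_root i + simple_root i = (\<beta> :: 'j \<Rightarrow> nat)"
  by (auto simp: simple_root_def fun_eq_iff)

lemma add_simple_root_diff: "\<beta> + simple_root i - simple_root i = (\<beta> :: 'j \<Rightarrow> nat)"
  by (auto simp: fun_eq_iff)

lemma the_simple_root: "(THE i. (\<gamma> :: 'j \<Rightarrow> nat) + simple_root k = \<gamma> + simple_root i) = k"
  by (auto simp: simple_root_inject)

lemma paths_0: "paths (0 :: 'j \<Rightarrow> nat) = {[0]}"
proof (intro equalityI subsetI)
  fix p :: "('j \<Rightarrow> nat) list" assume p: "p \<in> paths 0"
  then have "p \<noteq> []" by (simp add: paths_def)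
  then obtain q \<gamma> where q: "p = q @ [\<gamma>]" by (metis rev_exhaust)
  with p have \<gamma>: "\<gamma> = 0" by (simp add: paths_def)
  have "q = []"
  proof (rule ccontr)
    assume "q \<noteq> []"
    then have "Suc (length q - 1) < length p" and last: "p ! Suc (length q - 1) = 0"
      by (simp_all add: q \<gamma> nth_append)
    with p obtain i where "p ! Suc (length q - 1) = p ! (length q - 1) + simple_root i"
      unfolding paths_def by blast
    with last have "(0 :: 'j \<Rightarrow> nat) i = (p ! (length q - 1) + simple_root i) i"
      by metis
    then show False by (simp add: simple_root_def)
  qed
  with q \<gamma> show "p \<in> {[0]}" by simp
qed (simp add: paths_def)

text \<open>Subtraction is truncated, so \<beta> i \<noteq> 0 is what makes removing \<alpha>_i undo
  a genuine step.\<close>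

lemma snoc_in_paths_iff:
  fixes \<beta> :: "'j \<Rightarrow> nat"
  assumes "p \<noteq> []"
  shows "p @ [\<beta>] \<in> paths \<beta> \<longleftrightarrow> (\<exists>i. \<beta> i \<noteq> 0 \<and> p \<in> paths (\<beta> - simple_root i))"
proof
  assume P: "p @ [\<beta>] \<in> paths \<beta>"
  have steps: "\<exists>i. (p @ [\<beta>]) ! Suc k = (p @ [\<beta>]) ! k + simple_root i" if "k < length p" for k
    using P that by (simp add: paths_def)
  from steps[of "length p - 1"] assms obtain i where i: "\<beta> = last p + simple_root i"
    by (auto simp: nth_append last_conv_nth split: if_splits)
  have "\<beta> i \<noteq> 0" by (subst i) (simp add: simple_root_def)
  moreover have "\<beta> - simple_root i = last p" by (subst i) (rule add_simple_root_diff)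
  moreover have "\<exists>i. p ! Suc k = p ! k + simple_root i" if "Suc k < length p" for k
    using steps[of k] that by (simp add: nth_append)
  ultimately show "\<exists>i. \<beta> i \<noteq> 0 \<and> p \<in> paths (\<beta> - simple_root i)"
    using P assms by (auto simp: paths_def)
next
  assume "\<exists>i. \<beta> i \<noteq> 0 \<and> p \<in> paths (\<beta> - simple_root i)"
  then obtain i where i: "\<beta> i \<noteq> 0" and p: "p \<in> paths (\<beta> - simple_root i)" by blast
  have "\<exists>i. (p @ [\<beta>]) ! Suc k = (p @ [\<beta>]) ! k + simple_root i" if "k < length p" for k
  proof (cases "Suc k = length p")
    case True
    then have "p ! k = \<beta> - simple_root i"
      using p by (auto simp: paths_def last_conv_nth simp flip: True)
    then have "(p @ [\<beta>]) ! Suc k = (p @ [\<beta>]) ! k + simple_root i"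
      using True that diff_simple_root_add[of \<beta> i, OF i] by (simp add: nth_append)
    then show ?thesis by blast
  next
    case False
    with that p show ?thesis by (simp add: paths_def nth_append)
  qed
  with p show "p @ [\<beta>] \<in> paths \<beta>" by (simp add: paths_def)
qed

text \<open>Paths are sorted by their last step; \<beta> \<noteq> 0 rules out the one-vertex path,
  which has none.\<close>

lemma paths_eq_UN:
  fixes \<beta> :: "'j \<Rightarrow> nat"
  assumes "\<beta> \<noteq> 0"
  shows "paths \<beta> = (\<Union>i\<in>{i. \<beta> i \<noteq> 0}. (\<lambda>p. p @ [\<beta>]) ` paths (\<beta> - simple_root i))"
proof (intro equalityI subsetI)
  fix p assume p: "p \<in> paths \<beta>"
  then obtain q where q: "p = q @ [\<beta>]"
    by (cases p rule: rev_cases) (auto simp: paths_def)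
  have "q \<noteq> []" using p q assms by (auto simp: paths_def)
  with p q show "p \<in> (\<Union>i\<in>{i. \<beta> i \<noteq> 0}. (\<lambda>p. p @ [\<beta>]) ` paths (\<beta> - simple_root i))"
    using snoc_in_paths_iff by blast
next
  fix p assume "p \<in> (\<Union>i\<in>{i. \<beta> i \<noteq> 0}. (\<lambda>p. p @ [\<beta>]) ` paths (\<beta> - simple_root i))"
  then obtain i q where "\<beta> i \<noteq> 0" "q \<in> paths (\<beta> - simple_root i)" "p = q @ [\<beta>]" by blast
  moreover from this have "q \<noteq> []" by (auto simp: paths_def)
  ultimately show "p \<in> paths \<beta>" using snoc_in_paths_iff by blast
qed

lemma path_weight_snoc: "p \<noteq> [] \<Longrightarrow> path_weight v (p @ [\<beta>]) = path_weight v p / v \<beta>"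
  unfolding path_weight_def by (simp add: prod.atLeastLessThan_Suc Suc_leI nth_append)

lemma path_steps_snoc:
  fixes \<beta> :: "'j \<Rightarrow> nat"
  assumes "p \<in> paths (\<beta> - simple_root i)" "\<beta> i \<noteq> 0"
  shows "path_steps (p @ [\<beta>]) = path_steps p @ [i]"
proof -
  have p: "p \<noteq> []" "last p = \<beta> - simple_root i" using assms by (auto simp: paths_def)
  then have "[0..<length p] = [0..<length p - 1] @ [length p - 1]"
    by (metis Suc_diff_1 length_greater_0_conv upt_Suc_append zero_le)
  moreover have "(THE j. (p @ [\<beta>]) ! Suc (length p - 1) = (p @ [\<beta>]) ! (length p - 1) + simple_root j) = i"
    using the_simple_root[of "\<beta> - simple_root i" i] diff_simple_root_add[of \<beta> i, OF assms(2)] p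
    by (simp add: nth_append last_conv_nth)
  ultimately show ?thesis
    by (auto simp: path_steps_def nth_append intro!: arg_cong[of _ _ The])
qed

lemma Z_vector_0: "vector_space scale \<Longrightarrow> Z_vector scale \<pi> vac v 0 = vac"
  by (simp add: Z_vector_def paths_0 path_weight_def path_vector_def path_steps_def f_monomial_Nil
      vector_space.vector_space_assms)

text \<open>Z at \<beta> - \<alpha>_i, set to 0 outside the positive lattice, where truncated
  subtraction would return \<beta> itself. This lets the recursion be summed over all nodes.\<close>

definition Z_pred :: "(('j \<Rightarrow> nat) \<Rightarrow> 'v) \<Rightarrow> ('j \<Rightarrow> nat) \<Rightarrow> 'j \<Rightarrow> 'v::zero" where
  "Z_pred Z \<beta> i = (if \<beta> i = 0 then 0 else Z (\<beta> - simple_root i))"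

context highest_weight_rep
begin

text \<open>Appending \<beta> by a last step i multiplies the weight of a path by 1 / v \<beta> and
  applies f_i to its vector.\<close>

lemma Z_vector_recursion:
  assumes "\<beta> \<noteq> 0" "v \<beta> \<noteq> 0"
  shows "scale (v \<beta>) (Z_vector scale \<pi> vac v \<beta>)
     = (\<Sum>i\<in>UNIV. F i (Z_pred (Z_vector scale \<pi> vac v) \<beta> i))"
proof -
  let ?t = "\<lambda>p. scale (path_weight v p) (path_vector \<pi> vac p)"
  let ?I = "{i. \<beta> i \<noteq> 0}"
  have "Z_vector scale \<pi> vac v \<beta> = (\<Sum>i\<in>?I. sum ?t ((\<lambda>p. p @ [\<beta>]) ` paths (\<beta> - simple_root i)))"
    unfolding Z_vector_def paths_eq_UN[OF assms(1)]
  proof (rule sum.UNION_disjoint)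
    \<comment> \<open>The penultimate vertex determines the last step.\<close>
    show "\<forall>i\<in>?I. \<forall>j\<in>?I. i \<noteq> j \<longrightarrow> (\<lambda>p. p @ [\<beta>]) ` paths (\<beta> - simple_root i)
        \<inter> (\<lambda>p. p @ [\<beta>]) ` paths (\<beta> - simple_root j) = {}"
    proof (intro ballI impI, rule ccontr)
      fix i j assume ij: "i \<in> ?I" "j \<in> ?I" "i \<noteq> j"
        and "(\<lambda>p. p @ [\<beta>]) ` paths (\<beta> - simple_root i)
        \<inter> (\<lambda>p. p @ [\<beta>]) ` paths (\<beta> - simple_root j) \<noteq> {}"
      then obtain p where "p \<in> paths (\<beta> - simple_root i)" "p \<in> paths (\<beta> - simple_root j)"
        by auto
      then have "\<beta> - simple_root i = \<beta> - simple_root j" by (simp add: paths_def)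
      then have "\<beta> i - simple_root i i = \<beta> i - simple_root j i" by (metis minus_apply)
      with ij show False by (simp add: simple_root_def)
    qed
  qed (auto simp: finite_paths)
  also have "\<dots> = (\<Sum>i\<in>?I. \<Sum>p\<in>paths (\<beta> - simple_root i). ?t (p @ [\<beta>]))"
    by (simp add: sum.reindex inj_on_def)
  also have "\<dots> = (\<Sum>i\<in>?I. scale (1 / v \<beta>) (F i (Z_vector scale \<pi> vac v (\<beta> - simple_root i))))"
  proof (rule sum.cong[OF refl])
    fix i assume i: "i \<in> ?I"
    have "?t (p @ [\<beta>]) = scale (1 / v \<beta>) (F i (?t p))" if p: "p \<in> paths (\<beta> - simple_root i)" for p
    proof -
      have "p \<noteq> []" using p by (simp add: paths_def)
      with i p show ?thesis
        by (simp add: path_weight_snoc path_vector_def path_steps_snoc f_monomial_snoc op_scale)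
    qed
    then show "(\<Sum>p\<in>paths (\<beta> - simple_root i). ?t (p @ [\<beta>]))
        = scale (1 / v \<beta>) (F i (Z_vector scale \<pi> vac v (\<beta> - simple_root i)))"
      by (simp add: Z_vector_def op_sum scale_sum_right)
  qed
  also have "\<dots> = (\<Sum>i\<in>UNIV. scale (1 / v \<beta>) (F i (Z_pred (Z_vector scale \<pi> vac v) \<beta> i)))"
    by (rule sum.mono_neutral_cong_left) (auto simp: Z_pred_def)
  finally show ?thesis using assms(2) by (simp add: scale_sum_right)
qed

lemma Z_vector_piece: "Z_vector scale \<pi> vac v \<beta> \<in> piece \<beta>"
proof -
  have "sum_list (map simple_root (path_steps p)) = \<beta>" if "p \<in> paths \<beta>" for p
    using that
  proof (induction p arbitrary: \<beta> rule: rev_induct)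
    case (snoc \<gamma> q)
    then have \<gamma>: "\<gamma> = \<beta>" by (simp add: paths_def)
    show ?case
    proof (cases "q = []")
      case True
      with snoc(2) show ?thesis by (auto simp: paths_def path_steps_def)
    next
      case False
      then obtain i where i: "\<beta> i \<noteq> 0" "q \<in> paths (\<beta> - simple_root i)"
        using snoc(2) snoc_in_paths_iff unfolding \<gamma> by blast
      have "sum_list (map simple_root (path_steps (q @ [\<beta>]))) = \<beta> - simple_root i + simple_root i"
        by (simp add: path_steps_snoc[OF i(2,1)] flip: snoc(1)[OF i(2)])
      then show ?thesis using diff_simple_root_add[of \<beta> i, OF i(1)] by (simp add: \<gamma>)
    qed
  qed (simp add: paths_def)
  then show ?thesis
    unfolding Z_vector_def graded_piece_def path_vector_def
    by (intro span_sum span_scale span_base) blast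
qed

text \<open>The vertex weight is abstracted to its difference equation \<open>v_step\<close>, its
  value at 0 and its nonvanishing elsewhere. The induction is on the height of \<beta>.\<close>

theorem E_Z_vector:
  assumes d: "\<And>i. d i \<noteq> 0" and v0: "v 0 = 0" and v: "\<And>\<beta>. \<beta> \<noteq> 0 \<Longrightarrow> v \<beta> \<noteq> 0"
    and v_step: "\<And>\<beta> j. v (\<beta> + simple_root j) = v \<beta> + d j * piece_weight \<beta> j"
  shows "E j (Z_vector scale \<pi> vac v \<beta>) = scale (1 / d j) (Z_pred (Z_vector scale \<pi> vac v) \<beta> j)"
proof (induction "sum \<beta> UNIV" arbitrary: \<beta> j rule: less_induct)
  case less
  let ?Z = "Z_vector scale \<pi> vac v"
  \<comment> \<open>At \<beta> = 0 both sides vanish because v 0 = 0; this case recurs below as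
    \<gamma> = 0, when \<beta> is a simple root.\<close>
  have rec: "scale (v \<beta>) (?Z \<beta>) = (\<Sum>i\<in>UNIV. F i (Z_pred ?Z \<beta> i))" for \<beta>
  proof (cases "\<beta> = 0")
    case True
    then show ?thesis by (simp add: v0 Z_pred_def)
  qed (rule Z_vector_recursion, auto simp: v)
  show ?case
  proof (cases "\<beta> = 0")
    case True
    then show ?thesis by (simp add: Z_vector_0 vector_space_axioms E_vac Z_pred_def)
  next
    case False
    have IH: "E j (Z_pred ?Z \<beta> i)
        = scale (1 / d j) (if \<beta> i = 0 then 0 else Z_pred ?Z (\<beta> - simple_root i) j)" for i
    proof (cases "\<beta> i = 0")
      case ne: False
      have "sum (\<beta> - simple_root i) UNIV < sum \<beta> UNIV"
        using ne by (intro sum_strict_mono_ex1) (auto simp: simple_root_def intro!: exI[of _ i])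
      from less[OF this] ne show ?thesis by (simp add: Z_pred_def)
    qed (simp add: Z_pred_def)
    have "scale (v \<beta>) (E j (?Z \<beta>)) = E j (\<Sum>i\<in>UNIV. F i (Z_pred ?Z \<beta> i))"
      by (simp flip: rec add: op_scale)
    also have "\<dots> = (\<Sum>i\<in>UNIV. F i (E j (Z_pred ?Z \<beta> i))) + H j (Z_pred ?Z \<beta> j)"
      by (simp add: op_sum E_F sum.distrib)
    also have "(\<Sum>i\<in>UNIV. F i (E j (Z_pred ?Z \<beta> i)))
        = scale (1 / d j)
           (\<Sum>i\<in>UNIV. F i (if \<beta> i = 0 then 0 else Z_pred ?Z (\<beta> - simple_root i) j))"
      by (simp add: IH op_scale scale_sum_right)
    also have "\<dots> + H j (Z_pred ?Z \<beta> j) = scale (v \<beta>) (scale (1 / d j) (Z_pred ?Z \<beta> j))"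
    proof (cases "\<beta> j = 0")
      case True
      then have "(if \<beta> i = 0 then 0 else Z_pred ?Z (\<beta> - simple_root i) j) = 0" for i
        by (simp add: Z_pred_def)
      with True show ?thesis by (simp add: Z_pred_def)
    next
      case ne: False
      define \<gamma> where "\<gamma> = \<beta> - simple_root j"
      have \<beta>: "\<beta> = \<gamma> + simple_root j" using diff_simple_root_add[of \<beta> j, OF ne] by (simp add: \<gamma>_def)
      \<comment> \<open>Removing \<alpha>_i and \<alpha>_j commutes, so the sum becomes the
        recursion at \<gamma>, read backwards.\<close>
      have "(if \<beta> i = 0 then 0 else Z_pred ?Z (\<beta> - simple_root i) j) = Z_pred ?Z \<gamma> i" for i
      proof (cases "i = j")
        case False
        have "\<beta> - simple_root i - simple_root j = \<beta> - simple_root j - simple_root i"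
          by (auto simp: fun_eq_iff)
        with False ne show ?thesis by (auto simp: \<gamma>_def Z_pred_def simple_root_def)
      qed (use ne in \<open>simp add: \<gamma>_def Z_pred_def\<close>)
      then have "(\<Sum>i\<in>UNIV. F i (if \<beta> i = 0 then 0 else Z_pred ?Z (\<beta> - simple_root i) j))
          = scale (v \<gamma>) (?Z \<gamma>)"
        by (simp add: rec)
      moreover have "Z_pred ?Z \<beta> j = ?Z \<gamma>"
        using ne by (simp add: Z_pred_def \<gamma>_def)
      moreover have "H j (?Z \<gamma>) = scale (piece_weight \<gamma> j) (?Z \<gamma>)"
        by (rule H_piece) (rule Z_vector_piece)
      \<comment> \<open>The contributions v \<gamma> / d j and
        \<open>piece_weight \<gamma> j\<close> combine to v \<beta> / d j.\<close>
      moreover have "v \<beta> = v \<gamma> + d j * piece_weight \<gamma> j"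
        unfolding \<beta> by (rule v_step)
      ultimately show ?thesis
        using d[of j] by (simp flip: scale_left_distrib add: field_simps)
    qed
    finally show ?thesis by (rule scale_left_imp_eq[OF v[OF False]])
  qed
qed

end


section \<open>Uniqueness and existence of the Whittaker vector\<close>

section \<open>Whittaker vectors\<close>

text \<open>Induction on height: once both vectors agree in all degrees \<beta> - \<alpha>_i, the
  Whittaker condition makes their difference in degree \<beta> singular.\<close>

lemma (in verma_rep) whittaker_vector_unique:
  assumes irr: "irreducible_module scale \<pi>" and vac: "vac \<noteq> 0"
    and w: "is_whittaker_vector scale \<pi> vac \<mu> w" and w': "is_whittaker_vector scale \<pi> vac \<mu> w'"
  shows "w = w'"
proof -
  \<comment> \<open>The piece of degree 0 is the line of the nonzero vacuum, so the normalization
    fixes this component.\<close>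
  have w_0: "w 0 = vac" if "is_whittaker_vector scale \<pi> vac \<mu> w" for w
  proof -
    from that have "w 0 \<in> piece 0"
      by (simp add: is_whittaker_vector_def completion_def)
    then have "w 0 \<in> span {vac}" by (simp only: piece_0)
    then obtain c where c: "w 0 = scale c vac" by (auto simp: span_singleton)
    then have "vac_functional scale vac w = c"
      using vac by (simp add: vac_functional_def)
    with that c show ?thesis by (simp add: is_whittaker_vector_def)
  qed
  have "w \<beta> - w' \<beta> = 0" for \<beta>
  proof (induction "sum \<beta> UNIV" arbitrary: \<beta> rule: less_induct)
    case less
    show ?case
    proof (cases "\<beta> = 0")
      case True
      then show ?thesis using w_0[OF w] w_0[OF w'] by simp
    next
      case False
      have "w \<beta> \<in> piece \<beta>" "w' \<beta> \<in> piece \<beta>"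
        using w w' by (auto simp: is_whittaker_vector_def completion_def)
      then have p: "w \<beta> - w' \<beta> \<in> piece \<beta>" unfolding graded_piece_def by (rule span_diff)
      show ?thesis
      proof (rule singular_vector_eq_0[OF irr vac p False])
        fix i
        show "E i (w \<beta> - w' \<beta>) = 0"
        proof (cases "\<beta> i = 0")
          case True
          then show ?thesis by (rule E_piece_eq_0[OF p])
        next
          case ne: False
          let ?\<gamma> = "\<beta> - simple_root i"
          have "E i (u \<beta>) = scale (\<mu> i) (u ?\<gamma>)" if "is_whittaker_vector scale \<pi> vac \<mu> u" for u
          proof -
            have "completion_e \<pi> i u ?\<gamma> = scale (\<mu> i) (u ?\<gamma>)"
              using that by (simp add: is_whittaker_vector_def)
            then show ?thesis by (simp only: completion_e_def diff_simple_root_add[of \<beta> i, OF ne])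
          qed
          moreover have "sum ?\<gamma> UNIV < sum \<beta> UNIV"
            using ne by (intro sum_strict_mono_ex1) (auto simp: simple_root_def intro!: exI[of _ i])
          from less[OF this] have "w ?\<gamma> = w' ?\<gamma>" by simp
          ultimately show ?thesis using w w' by (simp add: op_diff)
        qed
      qed
    qed
  qed
  then show ?thesis by (simp add: fun_eq_iff)
qed

text \<open>Passing from \<beta> to \<beta> + \<alpha>_j multiplies the coefficient by d j * \<mu>
  j, while \<open>E_Z_vector\<close> contributes 1 / d j; the character value \<mu> j
  remains.\<close>

lemma (in highest_weight_rep) is_whittaker_vector_Z:
  assumes vac: "vac \<noteq> 0" and d: "\<And>i. d i \<noteq> 0"
    and v0: "v 0 = 0" and v: "\<And>\<beta>. \<beta> \<noteq> 0 \<Longrightarrow> v \<beta> \<noteq> 0"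
    and v_step: "\<And>\<beta> j. v (\<beta> + simple_root j) = v \<beta> + d j * piece_weight \<beta> j"
  shows "is_whittaker_vector scale \<pi> vac \<mu>
    (\<lambda>\<beta>. scale (\<Prod>i\<in>UNIV. (d i * \<mu> i) ^ \<beta> i) (Z_vector scale \<pi> vac v \<beta>))"
    (is "is_whittaker_vector _ _ _ _ ?w")
  unfolding is_whittaker_vector_def
proof (intro conjI allI ext)
  show "?w \<in> completion scale \<pi> vac"
    using Z_vector_piece unfolding completion_def graded_piece_def by (auto intro: span_scale)
  show "vac_functional scale vac ?w = 1"
  proof -
    have "(THE c. vac = scale c vac) = 1"
      using vac scale_right_imp_eq[of vac 1] by (intro the_equality) auto
    then show ?thesis by (simp add: vac_functional_def Z_vector_0 vector_space_axioms)
  qed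
next
  fix j \<beta>
  let ?Z = "Z_vector scale \<pi> vac v"
  have "E j (?Z (\<beta> + simple_root j)) = scale (1 / d j) (?Z \<beta>)"
    by (subst E_Z_vector[OF d v0 v v_step])
      (auto simp: Z_pred_def simple_root_def add_simple_root_diff[unfolded simple_root_def])
  moreover have "(\<Prod>i\<in>UNIV. (d i * \<mu> i) ^ (\<beta> + simple_root j) i)
      = (\<Prod>i\<in>UNIV. (d i * \<mu> i) ^ \<beta> i) * (d j * \<mu> j)"
  proof -
    have "(\<Prod>i\<in>UNIV. (d i * \<mu> i) ^ simple_root j i) = (\<Prod>i\<in>UNIV. if i = j then d i * \<mu> i else 1)"
      by (rule prod.cong) (auto simp: simple_root_def)
    then show ?thesis by (simp add: power_add prod.distrib)
  qed
  ultimately show "completion_e \<pi> j ?w \<beta> = scale (\<mu> j) (?w \<beta>)"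
    using d[of j] by (simp add: completion_e_def op_scale mult.commute)
qed


section \<open>The difference equation of the vertex weights\<close>

section \<open>The vertex weights\<close>

lemma vertex_weight_0: "vertex_weight C d a \<Lambda> 0 = 0"
  by (simp add: vertex_weight_def weight_root_form_def root_form_def)

lemma sum_simple_root:
  "(\<Sum>i\<in>UNIV. of_nat (simple_root j i) * g i) = g j"
  for g :: "'j::finite \<Rightarrow> 'b::comm_semiring_1"
proof -
  have "(\<Sum>i\<in>UNIV. of_nat (simple_root j i) * g i) = (\<Sum>i\<in>UNIV. if i = j then g i else 0)"
    by (rule sum.cong) (auto simp: simple_root_def)
  then show ?thesis by simp
qed

lemma coroot_label_add:
  "coroot_label d a (\<Lambda> + \<Lambda>') i = coroot_label d a \<Lambda> i + coroot_label d a \<Lambda>' i"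
  by (cases i) (simp_all add: sum.distrib distrib_left)

text \<open>Polarization gives (\<beta> + \<alpha>_j | \<beta> + \<alpha>_j) = (\<beta> | \<beta>) +
  2 (\<beta> | \<alpha>_j) + 2 d_j. Half of the last term cancels against the pairing d_j of
  \<open>rho_hat\<close> with \<alpha>_j, leaving d_j (\<Lambda> - \<beta> | coroot_j).\<close>

lemma vertex_weight_add_simple_root:
  assumes diag: "\<And>i. C i i = 2" and d0: "d None = 1"
    and sym: "\<And>i j. real_of_int (C i j) * d j = real_of_int (C j i) * d i"
  shows "vertex_weight C d a \<Lambda> (\<beta> + simple_root j) = vertex_weight C d a \<Lambda> \<beta>
    + complex_of_real (d j) *
       (coroot_label d a \<Lambda> j - (\<Sum>i\<in>UNIV. of_nat (\<beta> i) * of_int (C i j)))"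
proof -
  let ?s = "\<Sum>i\<in>UNIV. real (\<beta> i) * real_of_int (C i j)"
  have "root_form C d (\<beta> + simple_root j) (\<beta> + simple_root j)
      = root_form C d \<beta> \<beta> + root_form C d \<beta> (simple_root j)
        + root_form C d (simple_root j) \<beta> + root_form C d (simple_root j) (simple_root j)"
    by (simp add: root_form_def distrib_left distrib_right sum.distrib)
  moreover have "root_form C d \<gamma> (simple_root j)
      = (\<Sum>i\<in>UNIV. real (\<gamma> i) * real_of_int (C i j)) * d j" for \<gamma>
  proof -
    have "(\<Sum>k\<in>UNIV. real (\<gamma> i) * real (simple_root j k) * (real_of_int (C i k) * d k))
        = real (\<gamma> i) * real_of_int (C i j) * d j" for i
      using sum_simple_root[of j "\<lambda>k. real_of_int (C i k) * d k"]
      by (simp add: mult.assoc flip: sum_distrib_left)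
    then show ?thesis by (simp add: root_form_def sum_distrib_right)
  qed
  moreover have "root_form C d (simple_root j) \<beta> = root_form C d \<beta> (simple_root j)"
    unfolding root_form_def
  proof (subst sum.swap, intro sum.cong refl)
    fix i k
    show "real (simple_root j k) * real (\<beta> i) * (real_of_int (C k i) * d i)
        = real (\<beta> i) * real (simple_root j k) * (real_of_int (C i k) * d k)"
      using sym[of i k] by simp
  qed
  moreover have "(\<Sum>i\<in>UNIV. real (simple_root j i) * real_of_int (C i j)) = 2"
    by (simp add: sum_simple_root diag)
  ultimately have rf: "root_form C d (\<beta> + simple_root j) (\<beta> + simple_root j)
      = root_form C d \<beta> \<beta> + 2 * (?s * d j) + 2 * d j"
    by simp
  have "weight_root_form d a (\<Lambda> + rho_hat d a) (\<beta> + simple_root j)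
      = weight_root_form d a (\<Lambda> + rho_hat d a) \<beta>
        + complex_of_real (d j) * (coroot_label d a \<Lambda> j + 1)"
    using sum_simple_root[of j "\<lambda>i. complex_of_real (d i) * (coroot_label d a \<Lambda> i + 1)"]
    by (simp add: weight_root_form_def coroot_label_add coroot_label_rho_hat[where d = d, OF d0]
        distrib_right sum.distrib mult.assoc)
  with rf show ?thesis
    by (simp add: vertex_weight_def algebra_simps add_divide_distrib)
qed

theorem theorem4p3:
  fixes scale_g :: "complex \<Rightarrow> 'g::ab_group_add \<Rightarrow> 'g" and br :: "'g \<Rightarrow> 'g \<Rightarrow> 'g"
    and e f h :: "'i::finite \<Rightarrow> 'g" and a :: "'i \<Rightarrow> nat"
    and C :: "'i option \<Rightarrow> 'i option \<Rightarrow> int" and d :: "'i option \<Rightarrow> real"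
    and scale :: "complex \<Rightarrow> 'v::ab_group_add \<Rightarrow> 'v"
    and \<pi> :: "'i option chevalley \<Rightarrow> 'v \<Rightarrow> 'v" and vac :: 'v
    and k :: complex and l :: "'i \<Rightarrow> complex" and \<mu> :: "'i option \<Rightarrow> complex"
  assumes affine: "nontwisted_affine_data scale_g br e f h a C d"
    and level: "\<And>n::nat. n > 0 \<Longrightarrow> k \<noteq> of_nat n"
    and noncritical: "k \<noteq> - complex_of_real (dual_coxeter d a)"
    and verma: "is_verma_module scale C (coroot_label d a (k, l)) \<pi> vac"
    and generic: "generic_weight scale \<pi> C d a (k, l)"
    and mu_nonzero: "\<And>i. \<mu> i \<noteq> 0"
  shows "(\<exists>!w. is_whittaker_vector scale \<pi> vac \<mu> w) \<and>
    (THE w. is_whittaker_vector scale \<pi> vac \<mu> w) =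
      (\<lambda>\<beta>. scale (\<Prod>i\<in>UNIV. (complex_of_real (d i) * \<mu> i) ^ \<beta> i)
             (Z_vector scale \<pi> vac (vertex_weight C d a (k, l)) \<beta>))"
proof -
  let ?label = "coroot_label d a (k, l)" and ?v = "vertex_weight C d a (k, l)"
  interpret kac_moody_rep scale \<pi> C
    using verma by (simp add: kac_moody_rep_iff is_verma_module_def)
  have act_vac: "act p vac = 0 \<longleftrightarrow> p \<in> verma_ideal C ?label" for p
    using verma by (simp add: is_verma_module_def)
  have "free_generator (Gen_e i) \<in> verma_ideal C ?label"
    "free_generator (Gen_h i) - free_const (?label i) \<in> verma_ideal C ?label" for i
    unfolding verma_ideal_def left_ideal_generated_def by blast+
  then have "act (free_generator (Gen_e i)) vac = 0"
    "act (free_generator (Gen_h i) - free_const (?label i)) vac = 0" for i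
    using act_vac by blast+
  then interpret verma_rep scale \<pi> C ?label vac
    using verma act_vac by unfold_locales (simp_all add: act_diff is_verma_module_def)
  have irr: "irreducible_module scale \<pi>" and v: "\<And>\<beta>. \<beta> \<noteq> 0 \<Longrightarrow> ?v \<beta> \<noteq> 0"
    using generic by (auto simp: generic_weight_def)
  have vac: "vac \<noteq> 0"
  proof
    assume "vac = 0"
    then have "u = 0" for u :: 'v using vac_generates[of u] by auto
    then show False using irr by (auto simp: irreducible_module_def)
  qed
  have diag: "C i i = 2" and d_None: "d None = 1" and pos: "d i > 0"
    and sym: "real_of_int (C i j) * d j = real_of_int (C j i) * d i" for i j
    using affine unfolding nontwisted_affine_data_def generalized_cartan_matrix_def by blast+
  have d: "complex_of_real (d i) \<noteq> 0" for i
    using pos[of i] by simp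
  \<comment> \<open>Here the vertex weights meet the module: their increment along \<alpha>_j is d_j
    times the eigenvalue of h_j in degree \<beta>.\<close>
  have v_step: "?v (\<beta> + simple_root j) = ?v \<beta> + complex_of_real (d j) * piece_weight \<beta> j" for \<beta> j
    unfolding piece_weight_def by (rule vertex_weight_add_simple_root[of C d, OF diag d_None sym])
  let ?w = "\<lambda>\<beta>. scale (\<Prod>i\<in>UNIV. (complex_of_real (d i) * \<mu> i) ^ \<beta> i)
    (Z_vector scale \<pi> vac ?v \<beta>)"
  have "is_whittaker_vector scale \<pi> vac \<mu> ?w"
    by (rule is_whittaker_vector_Z[OF vac d vertex_weight_0 v v_step])
  moreover have "w = ?w" if "is_whittaker_vector scale \<pi> vac \<mu> w" for w
    using whittaker_vector_unique[OF irr vac that calculation] .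
  ultimately show ?thesis
    by (intro conjI ex1I[of _ ?w] the_equality)
qed

end
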